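(* For all real $x$ with $0<x<\frac{\pi}{2}$ one has $$\frac{\sinh x}{x}<\frac{3}{2+\cos x}<\frac{2+\cosh x}{3}.$$ *)

theory Defs
  imports Complex_Main
begin

end

(* Everything reduces to cos x * cosh x < 1 on (0, pi/2), which follows by differentiating twice.
   It gives sin x > tanh x (compare squares), so 3x - (2 + cos x) sinh x is strictly convex with
   vanishing value and slope at 0.  It also gives cos x + cosh x > 2 cos x cosh x by AM-GM; since
   (cos * cosh)'''' = -4 cos * cosh, this says that (2 + cos x)(2 + cosh x) - 9 has positive
   fourth derivative, and its derivatives of order 0 to 3 vanish at 0. *)
theory Submission
  imports Defs
begin

text \<open>Monotonicity packaged for chaining: positivity of \<open>f'\<close> is asked only on the
  open interval from 0 to \<open>b\<close>, which is also where positivity of \<open>f\<close> is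
  concluded, so each application feeds the next, one order of differentiation lower.\<close>

lemma pos_if_deriv_pos:
  fixes f f' :: "real \<Rightarrow> real"
  assumes "f 0 = 0" and "\<And>t. (f has_real_derivative f' t) (at t)"
    and "\<And>t. 0 < t \<Longrightarrow> t < b \<Longrightarrow> 0 < f' t"
    and "0 < x" and "x < b"
  shows "0 < f x"
proof -
  have "f 0 < f x"
  proof (rule DERIV_pos_imp_increasing_open[OF \<open>0 < x\<close>])
    fix t assume "0 < t" "t < x"
    then show "\<exists>y. (f has_real_derivative y) (at t) \<and> 0 < y"
      using assms by (meson less_trans)
  next
    show "continuous_on {0..x} f"
      using assms(2) by (meson DERIV_isCont continuous_at_imp_continuous_on)
  qed
  then show ?thesis using \<open>f 0 = 0\<close> by simp
qed

lemma cos_mult_cosh_less_one: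
  fixes x :: real
  assumes "0 < x" and "x < pi / 2"
  shows "cos x * cosh x < 1"
proof -
  \<comment> \<open>This is the derivative of \<open>1 - cos t * cosh t\<close>. Differentiating
    again cancels the \<open>cos t * cosh t\<close> terms and leaves
    \<open>2 * sin t * sinh t\<close>.\<close>
  have slope: "0 < sin t * cosh t - cos t * sinh t" if "0 < t" "t < pi / 2" for t :: real
  proof (rule pos_if_deriv_pos[OF _ _ _ that])
    show "((\<lambda>t. sin t * cosh t - cos t * sinh t) has_real_derivative 2 * sin s * sinh s) (at s)"
      for s :: real
      by (auto intro!: derivative_eq_intros simp: algebra_simps)
    show "0 < 2 * sin s * sinh s" if "0 < s" "s < pi / 2" for s :: real
      using that by (simp add: sin_gt_zero)
  qed simp
  have "0 < 1 - cos x * cosh x"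
  proof (rule pos_if_deriv_pos[OF _ _ slope assms])
    show "((\<lambda>t. 1 - cos t * cosh t) has_real_derivative sin t * cosh t - cos t * sinh t) (at t)"
      for t :: real
      by (auto intro!: derivative_eq_intros simp: algebra_simps)
  qed auto
  then show ?thesis by simp
qed

lemma sinh_less_sin_mult_cosh:
  fixes x :: real
  assumes "0 < x" and "x < pi / 2"
  shows "sinh x < sin x * cosh x"
proof (rule power2_less_imp_less)
  have "0 < cos x" using assms by (intro cos_gt_zero) auto
  then have "(cos x * cosh x)\<^sup>2 < 1"
    using cos_mult_cosh_less_one[OF assms] by (simp add: power_less_one_iff)
  \<comment> \<open>Substituting 1 - cos^2 for sin^2 and cosh^2 - 1 for sinh^2, the right side minus
    the left is exactly \<open>1 - (cos x * cosh x)\<^sup>2\<close>.\<close>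
  then show "(sinh x)\<^sup>2 < (sin x * cosh x)\<^sup>2"
    by (simp add: power_mult_distrib sin_squared_eq sinh_square_eq algebra_simps)
  show "0 \<le> sin x * cosh x"
    using assms by (simp add: sin_ge_zero)
qed

lemma cos_add_cosh_greater:
  fixes x :: real
  assumes "0 < x" and "x < pi / 2"
  shows "2 * cos x * cosh x < cos x + cosh x"
proof (rule power2_less_imp_less)
  define p where "p = cos x * cosh x"
  have "0 < cos x" using assms by (intro cos_gt_zero) auto
  then have "0 < p" by (simp add: p_def)
  moreover have "p < 1" using cos_mult_cosh_less_one[OF assms] by (simp add: p_def)
  \<comment> \<open>The chain is (2p)^2 < 4p <= (cos x + cosh x)^2: the strict step is this one
    times 4, the other is (cos x - cosh x)^2 >= 0.\<close>
  ultimately have "p * p < p" by simp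
  moreover have "4 * p \<le> (cos x + cosh x)\<^sup>2"
    using zero_le_power2[of "cos x - cosh x"] unfolding p_def power2_eq_square
    by (simp add: algebra_simps)
  ultimately show "(2 * cos x * cosh x)\<^sup>2 < (cos x + cosh x)\<^sup>2"
    unfolding p_def power2_eq_square by (simp add: algebra_simps)
  show "0 \<le> cos x + cosh x" using \<open>0 < cos x\<close> by (simp add: add_nonneg_nonneg)
qed

lemma sinh_mult_two_add_cos_less:
  fixes x :: real
  assumes "0 < x" and "x < pi / 2"
  shows "sinh x * (2 + cos x) < 3 * x"
proof -
  \<comment> \<open>In the derivative of this slope the \<open>sinh t * cos t\<close> terms cancel,
    leaving twice the difference of the sides in \<open>sinh_less_sin_mult_cosh\<close>.\<close>
  have slope: "0 < 3 - cosh t * (2 + cos t) + sinh t * sin t" if "0 < t" "t < pi / 2" for t :: real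
  proof (rule pos_if_deriv_pos[OF _ _ _ that])
    show "((\<lambda>t. 3 - cosh t * (2 + cos t) + sinh t * sin t) has_real_derivative
        2 * (sin s * cosh s - sinh s)) (at s)" for s :: real
      by (auto intro!: derivative_eq_intros simp: algebra_simps)
    show "0 < 2 * (sin s * cosh s - sinh s)" if "0 < s" "s < pi / 2" for s :: real
      using sinh_less_sin_mult_cosh[OF that] by simp
  qed simp
  have "0 < 3 * x - sinh x * (2 + cos x)"
  proof (rule pos_if_deriv_pos[OF _ _ slope assms])
    show "((\<lambda>t. 3 * t - sinh t * (2 + cos t)) has_real_derivative
        3 - cosh t * (2 + cos t) + sinh t * sin t) (at t)" for t :: real
      by (auto intro!: derivative_eq_intros simp: algebra_simps)
  qed auto
  then show ?thesis by simp
qed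

lemma two_add_cos_mult_two_add_cosh_greater:
  fixes x :: real
  assumes "0 < x" and "x < pi / 2"
  shows "9 < (2 + cos x) * (2 + cosh x)"
proof -
  \<comment> \<open>\<open>?g1\<close>, \<open>?g2\<close>, \<open>?g3\<close> are the successive
    derivatives of (2 + cos t)(2 + cosh t) - 9. Positivity starts from the derivative of
    \<open>?g3\<close>, where \<open>cos_add_cosh_greater\<close> applies, and is passed back
    down.\<close>
  let ?g1 = "\<lambda>t::real. - sin t * (2 + cosh t) + (2 + cos t) * sinh t"
  let ?g2 = "\<lambda>t::real. 2 * cosh t - 2 * cos t - 2 * sin t * sinh t"
  let ?g3 = "\<lambda>t::real. 2 * sinh t + 2 * sin t - 2 * cos t * sinh t - 2 * sin t * cosh t"
  have g3: "0 < ?g3 t" if "0 < t" "t < pi / 2" for t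
  proof (rule pos_if_deriv_pos[OF _ _ _ that])
    show "(?g3 has_real_derivative 2 * (cos s + cosh s - 2 * cos s * cosh s)) (at s)" for s
      by (auto intro!: derivative_eq_intros simp: algebra_simps)
    show "0 < 2 * (cos s + cosh s - 2 * cos s * cosh s)" if "0 < s" "s < pi / 2" for s :: real
      using cos_add_cosh_greater[OF that] by simp
  qed simp
  have g2: "0 < ?g2 t" if "0 < t" "t < pi / 2" for t
  proof (rule pos_if_deriv_pos[OF _ _ g3 that])
    show "(?g2 has_real_derivative ?g3 s) (at s)" for s
      by (auto intro!: derivative_eq_intros simp: algebra_simps)
  qed auto
  have g1: "0 < ?g1 t" if "0 < t" "t < pi / 2" for t
  proof (rule pos_if_deriv_pos[OF _ _ g2 that])
    show "(?g1 has_real_derivative ?g2 s) (at s)" for s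
      by (auto intro!: derivative_eq_intros simp: algebra_simps)
  qed auto
  have "0 < (2 + cos x) * (2 + cosh x) - 9"
  proof (rule pos_if_deriv_pos[OF _ _ g1 assms])
    show "((\<lambda>t. (2 + cos t) * (2 + cosh t) - 9) has_real_derivative ?g1 t) (at t)" for t
      by (auto intro!: derivative_eq_intros simp: algebra_simps)
  qed auto
  then show ?thesis by simp
qed

theorem theorem4p1:
  fixes x :: real
  assumes "0 < x" and "x < pi / 2"
  shows "sinh x / x < 3 / (2 + cos x) \<and> 3 / (2 + cos x) < (2 + cosh x) / 3"
proof -
  \<comment> \<open>With all denominators positive, cross-multiplying turns the two inequalities
    into the two preceding lemmas.\<close>
  have "0 < 2 + cos x" using cos_ge_minus_one[of x] by linarith
  then show ?thesis
    using sinh_mult_two_add_cos_less[OF assms] two_add_cos_mult_two_add_cosh_greater[OF assms]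
      \<open>0 < x\<close>
    by (simp add: divide_less_eq less_divide_eq mult.commute)
qed

end
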